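(* Let $k \ge 1$ and $p \ge 2$ be integers. Then $$\mathcal{C}_{\mathrm{imp}}(k,p) \leq \begin{cases} \frac{2k-p}{k-1} & \text{if } k \ge 2 \text{ and } p \le 2k, \\ 0 & \text{if } p > 2k, \\ 2 & \text{if } k = 1 \text{ and } p = 2.\end{cases}$$
   Context: A linear multistep method (LM method) with $k$ steps computes $u_n = \sum_{j=1}^{k} \alpha_j u_{n-j} + h \sum_{j=0}^k \beta_j f(u_{n-j})$ and is identified with its real coefficients $(\alpha_j)_{j=1}^k$, $(\beta_j)_{j=0}^k$ (no requirement that $\alpha_k$ or $\beta_k$ be non-zero). In the class of implicit methods, $\beta_0$ is unrestricted (the value $\beta_0=0$ is allowed). With the convention $0^0=1$, a method has order $p$ if $\sum_{j=1}^{k}\alpha_j=1$ and $\sum_{j=1}^{k}(j^m\alpha_j - m j^{m-1}\beta_j) - m\,0^{m-1}\beta_0=0$ for all $1\le m\le p$. The SSP coefficient of a method is $\mathcal{C}=\min\{\alpha_j/\beta_j : 1\le j\le k,\ \beta_j\ne 0\}$ (with $\min\emptyset=+\infty$) if $\alpha_j\ge 0$ for $1\le j\le k$ and $\beta_j\ge 0$ for $0\le j\le k$, and $\mathcal{C}=0$ otherwise. $\mathcal{C}_{\mathrm{imp}}(k,p)$ is the supremum of $\mathcal{C}$ over all implicit $k$-step LM methods of order $p$, taken to be $0$ if there are no such methods. *)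

theory Defs
  imports Complex_Main "HOL-Library.Extended_Real"
begin

text \<open>
  A \<open>k\<close>-step linear multistep method
  \<open>u\<^sub>n = (\<Sum>j=1..k. \<alpha> j * u\<^sub>n\<^sub>-\<^sub>j) + h * (\<Sum>j=0..k. \<beta> j * f u\<^sub>n\<^sub>-\<^sub>j)\<close> is given by coefficient
  functions \<open>\<alpha>\<close>, \<open>\<beta>\<close>, of which only \<open>\<alpha> 1, \<dots>, \<alpha> k\<close> and \<open>\<beta> 0, \<dots>, \<beta> k\<close> are ever used.
  The value of \<open>\<beta> 0\<close> is unrestricted, so explicit methods are included.
\<close>

text \<open>Order at least \<open>p\<close>; \<open>0 ^ 0 = 1\<close> holds in HOL, so \<open>\<beta> 0\<close> enters only for \<open>m = 1\<close>.\<close>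

definition has_order :: "nat \<Rightarrow> (nat \<Rightarrow> real) \<Rightarrow> (nat \<Rightarrow> real) \<Rightarrow> nat \<Rightarrow> bool" where
  "has_order k \<alpha> \<beta> p \<longleftrightarrow>
     (\<Sum>j=1..k. \<alpha> j) = 1 \<and>
     (\<forall>m. 1 \<le> m \<and> m \<le> p \<longrightarrow>
        (\<Sum>j=1..k. real j ^ m * \<alpha> j - real m * real j ^ (m - 1) * \<beta> j)
          - real m * 0 ^ (m - 1) * \<beta> 0 = 0)"

definition ssp_coeff :: "nat \<Rightarrow> (nat \<Rightarrow> real) \<Rightarrow> (nat \<Rightarrow> real) \<Rightarrow> ereal" where
  "ssp_coeff k \<alpha> \<beta> =
     (if (\<forall>j\<in>{1..k}. 0 \<le> \<alpha> j) \<and> (\<forall>j\<in>{0..k}. 0 \<le> \<beta> j)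
      then (let R = {\<alpha> j / \<beta> j | j. j \<in> {1..k} \<and> \<beta> j \<noteq> 0}
            in if R = {} then \<infinity> else ereal (Min R))
      else 0)"

text \<open>The empty case is separate because \<open>Sup {} = -\<infinity>\<close> in \<^typ>\<open>ereal\<close>.\<close>

definition C_imp :: "nat \<Rightarrow> nat \<Rightarrow> ereal" where
  "C_imp k p =
     (if \<exists>\<alpha> \<beta>. has_order k \<alpha> \<beta> p
      then Sup {ssp_coeff k \<alpha> \<beta> | \<alpha> \<beta>. has_order k \<alpha> \<beta> p}
      else 0)"

end

theory Submission
  imports Defs "HOL-Computational_Algebra.Polynomial"
begin

text \<open>
  A method of order \<open>p\<close> satisfies
  \<open>(\<Sum>j=1..k. \<alpha> j * P j - \<beta> j * P' j) = P 0 + \<beta> 0 * P' 0\<close> for every polynomial \<open>P\<close> of degree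
  at most \<open>p\<close>, so suitable test polynomials give the bounds.
  For \<open>p > 2k\<close>, the polynomials \<open>Q = (\<Prod>j=1..k. x - j)\<^sup>2\<close> and \<open>x * Q\<close> show that no method exists.
  For \<open>p \<le> 2k\<close>, take \<open>P = x\<^sup>2 * (k - x) ^ (p - 2)\<close>: then \<open>P 0 = P' 0 = 0\<close>, and the logarithmic
  derivative \<open>2 / x - (p - 2) / (k - x)\<close> decreases on \<open>[1, k)\<close> from its value
  \<open>(2k - p) / (k - 1)\<close> at \<open>x = 1\<close>. An SSP coefficient larger than this makes every summand
  nonnegative, hence zero, and only \<open>\<alpha> k\<close>, \<open>\<beta> k\<close> and \<open>\<beta> 0\<close> can survive.
\<close>

text \<open>The order conditions are this identity for the monomials of degree at most
  \<open>p\<close>, and both sides are linear in \<open>P\<close>.\<close>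

lemma has_order_poly:
  assumes ord: "has_order k \<alpha> \<beta> p" and deg: "degree P \<le> p"
  shows "(\<Sum>j=1..k. \<alpha> j * poly P (real j) - \<beta> j * poly (pderiv P) (real j))
           = poly P 0 + \<beta> 0 * poly (pderiv P) 0"
proof -
  define L where "L P = (\<Sum>j=1..k. \<alpha> j * poly P (real j) - \<beta> j * poly (pderiv P) (real j))
           - poly P 0 - \<beta> 0 * poly (pderiv P) 0" for P
  have L_add: "L (P + Q) = L P + L Q" for P Q
    by (simp add: L_def pderiv_add sum.distrib sum_subtractf algebra_simps)
  have L_monom: "L (monom a m) = 0" if "m \<le> p" for a m
  proof (cases "m = 0")
    case True
    have "(\<Sum>j=1..k. \<alpha> j) = 1"
      using ord by (simp add: has_order_def)
    then have "(\<Sum>j=1..k. \<alpha> j * a) = a"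
      by (simp flip: sum_distrib_right)
    then show ?thesis
      using True by (simp add: L_def monom_0)
  next
    case False
    then have "(\<Sum>j=1..k. real j ^ m * \<alpha> j - real m * real j ^ (m - 1) * \<beta> j)
          - real m * 0 ^ (m - 1) * \<beta> 0 = 0"
      using ord that by (simp add: has_order_def)
    then have "a * ((\<Sum>j=1..k. real j ^ m * \<alpha> j - real m * real j ^ (m - 1) * \<beta> j)
          - real m * 0 ^ (m - 1) * \<beta> 0) = 0"
      by simp
    then show ?thesis
      using False
      by (simp add: L_def pderiv_monom poly_monom sum_distrib_left right_diff_distrib mult_ac)
  qed
  have "L (\<Sum>i\<le>n. monom (coeff P i) i) = 0" if "n \<le> p" for n
    using that by (induction n) (simp_all add: L_monom L_add)
  then have "L P = 0"
    using poly_as_sum_of_monoms'[OF deg] by (metis order_refl)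
  then show ?thesis
    by (simp add: L_def)
qed

text \<open>\<open>R * R\<close> has a double zero at each of the nodes \<open>1..k\<close>, so for
  it and for its product with \<open>x\<close> only the terms at 0 are left in
  \<open>has_order_poly\<close>.\<close>

lemma order_le_twice_steps:
  assumes ord: "has_order k \<alpha> \<beta> p"
  shows "p \<le> 2 * k"
proof (rule ccontr)
  assume "\<not> p \<le> 2 * k"
  define R :: "real poly" where "R = (\<Prod>j=1..k. [:- real j, 1:])"
  have deg_R: "degree R \<le> k"
    unfolding R_def by (rule order_trans[OF degree_prod_sum_le]) simp_all
  have R_0: "poly R 0 \<noteq> 0"
    by (simp add: R_def poly_prod)
  have R_j: "poly R (real j) = 0" if "j \<in> {1..k}" for j
    using that by (simp add: R_def poly_prod)
  have deg_R2: "degree (R * R) \<le> 2 * k"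
    using degree_mult_le[of R R] deg_R by linarith
  then have "degree ([:0, 1:] * (R * R)) \<le> p"
    using degree_mult_le[of "[:0, 1:]" "R * R"] \<open>\<not> p \<le> 2 * k\<close> by simp
  \<comment> \<open>At 0 the polynomial \<open>x * R * R\<close> has value 0 and derivative
    \<open>poly R 0 * poly R 0\<close>, which isolates \<open>\<beta> 0\<close>.\<close>
  from has_order_poly[OF ord this] have "\<beta> 0 = 0"
    using R_0 R_j by (simp add: pderiv_mult pderiv_pCons)
  moreover have "degree (R * R) \<le> p"
    using deg_R2 \<open>\<not> p \<le> 2 * k\<close> by linarith
  from has_order_poly[OF ord this] have "poly R 0 * poly R 0 + \<beta> 0 * poly (pderiv (R * R)) 0 = 0"
    using R_j by (simp add: pderiv_mult)
  ultimately show False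
    using R_0 by simp
qed

text \<open>As \<open>0 \<le> c\<close>, the default value 0 is excluded, so the sign conditions
  hold. Where \<open>\<beta> j = 0\<close> there is no ratio, and \<open>\<alpha> j\<close> may be 0
  too; hence the premise of the strict inequality.\<close>

lemma less_ssp_coeffD:
  assumes "0 \<le> c" and less: "ereal c < ssp_coeff k \<alpha> \<beta>" and j: "j \<in> {1..k}"
  shows "0 \<le> \<alpha> j" "0 \<le> \<beta> j" "\<beta> j \<noteq> 0 \<Longrightarrow> c * \<beta> j < \<alpha> j"
proof -
  have nonneg: "(\<forall>j\<in>{1..k}. 0 \<le> \<alpha> j) \<and> (\<forall>j\<in>{0..k}. 0 \<le> \<beta> j)"
    using less \<open>0 \<le> c\<close> by (auto simp: ssp_coeff_def split: if_splits)
  then show "0 \<le> \<alpha> j" and \<beta>: "0 \<le> \<beta> j"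
    using j by auto
  define R where "R = {\<alpha> j / \<beta> j | j. j \<in> {1..k} \<and> \<beta> j \<noteq> 0}"
  assume "\<beta> j \<noteq> 0"
  then have R: "\<alpha> j / \<beta> j \<in> R"
    using j by (auto simp: R_def)
  moreover have "finite R"
    by (simp add: R_def)
  moreover have "ssp_coeff k \<alpha> \<beta> = ereal (Min R)"
    unfolding ssp_coeff_def Let_def R_def[symmetric] using nonneg R by auto
  then have "c < Min R"
    using less by simp
  ultimately have "c < \<alpha> j / \<beta> j"
    using Min_le order_less_le_trans by blast
  then show "c * \<beta> j < \<alpha> j"
    using \<beta> \<open>\<beta> j \<noteq> 0\<close> by (simp add: pos_less_divide_eq)
qed

text \<open>The bound \<open>0 \<le> c\<close> serves the case without methods, where
  \<open>C_imp\<close> is 0.\<close>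

lemma C_imp_le:
  assumes "\<And>\<alpha> \<beta>. has_order k \<alpha> \<beta> p \<Longrightarrow> ssp_coeff k \<alpha> \<beta> \<le> c" and "0 \<le> c"
  shows "C_imp k p \<le> c"
  using assms by (auto simp: C_imp_def intro!: Sup_least)

text \<open>This is the bound on the logarithmic derivative, multiplied by \<open>P\<close> so that
  it makes sense at the zero \<open>j = k\<close> as well.\<close>

lemma test_poly_deriv_le:
  fixes k n j :: nat
  assumes "k \<ge> 2" and "1 \<le> j" and "j \<le> k"
  defines "P \<equiv> [:0, 1:] ^ 2 * [:real k, - 1:] ^ n"
  shows "poly (pderiv P) (real j) \<le> (2 - real n / (real k - 1)) * poly P (real j)"
proof -
  have P: "poly P (real j) = real j ^ 2 * (real k - real j) ^ n"
    by (simp add: P_def poly_power)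
  have P': "poly (pderiv P) (real j)
      = 2 * real j * (real k - real j) ^ n - real j ^ 2 * (real n * (real k - real j) ^ (n - 1))"
    by (simp add: P_def pderiv_mult pderiv_power pderiv_pCons poly_power power2_eq_square
        algebra_simps)
  show ?thesis
  proof (cases n)
    case 0
    have "real j * 1 \<le> real j * real j"
      using assms by (intro mult_left_mono) auto
    then show ?thesis
      unfolding P P' using 0 by (simp add: power2_eq_square)
  next
    case (Suc m)
    show ?thesis
    proof (cases "j = k")
      case True
      \<comment> \<open>Here \<open>P\<close> vanishes, and its derivative is
        \<open>- (real k ^ 2 * real n * 0 ^ m)\<close>, which is at most 0 even for
        \<open>m = 0\<close>.\<close>
      then show ?thesis
        unfolding P P' using Suc by simp
    next
      case False
      define d where "d = real k - real j"
      have d: "d > 0" "d \<le> real k - 1" and j: "real j \<ge> 1"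
        using False assms by (auto simp: d_def)
      have "real n / (real k - 1) \<le> real n / d"
        using d by (intro divide_left_mono) auto
      moreover have "2 / real j \<le> 2"
        using j by (simp add: divide_le_eq)
      ultimately have "2 / real j - real n / d \<le> 2 - real n / (real k - 1)"
        by linarith
      then have "(2 / real j - real n / d) * (real j ^ 2 * d ^ n)
          \<le> (2 - real n / (real k - 1)) * (real j ^ 2 * d ^ n)"
        using d by (intro mult_right_mono) auto
      moreover have "(2 / real j - real n / d) * (real j ^ 2 * d ^ n)
          = 2 * real j * d ^ n - real j ^ 2 * (real n * d ^ (n - 1))"
        using d j Suc by (simp add: field_simps power2_eq_square)
      ultimately show ?thesis
        unfolding P P' d_def[symmetric] by simp
    qed
  qed
qed

lemma ssp_coeff_le:
  assumes k: "k \<ge> 2" and p: "p \<ge> 2" "p \<le> 2 * k" and ord: "has_order k \<alpha> \<beta> p"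
  shows "ssp_coeff k \<alpha> \<beta> \<le> ereal ((2 * real k - real p) / (real k - 1))"
proof (rule ccontr)
  define c where "c = (2 * real k - real p) / (real k - 1)"
  define n where "n = p - 2"
  define P where "P = [:0, 1:] ^ 2 * [:real k, - 1:] ^ n"
  assume "\<not> ssp_coeff k \<alpha> \<beta> \<le> ereal ((2 * real k - real p) / (real k - 1))"
  then have less: "ereal c < ssp_coeff k \<alpha> \<beta>"
    by (simp add: c_def)
  have "0 \<le> c"
    using k p by (simp add: c_def)
  note ssp = less_ssp_coeffD[OF this less]
  have c: "c = 2 - real n / (real k - 1)"
    using k p by (simp add: c_def n_def field_simps of_nat_diff)
  have "degree P \<le> degree ([:0, 1:] ^ 2 :: real poly) + degree ([:real k, - 1:] ^ n)"
    unfolding P_def by (rule degree_mult_le)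
  also have "\<dots> \<le> p"
    using p by (simp add: degree_power_eq n_def)
  finally have deg: "degree P \<le> p" .
  define t where "t j = \<alpha> j * poly P (real j) - \<beta> j * poly (pderiv P) (real j)" for j
  \<comment> \<open>The factor \<open>x ^ 2\<close> removes both terms at 0, including the one with
    \<open>\<beta> 0\<close>.\<close>
  have sum_t: "(\<Sum>j=1..k. t j) = 0"
    unfolding t_def has_order_poly[OF ord deg]
    by (simp add: P_def pderiv_mult pderiv_power pderiv_pCons power2_eq_square)
  have P_j: "poly P (real j) = real j ^ 2 * (real k - real j) ^ n" for j
    by (simp add: P_def poly_power)
  have le: "c * \<beta> j \<le> \<alpha> j" if "j \<in> {1..k}" for j
    using ssp[OF that] by (cases "\<beta> j = 0") auto
  have t_ge: "(\<alpha> j - c * \<beta> j) * poly P (real j) \<le> t j" if "j \<in> {1..k}" for j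
  proof -
    have "\<beta> j * poly (pderiv P) (real j) \<le> \<beta> j * (c * poly P (real j))"
      using that test_poly_deriv_le[OF k, of j n] ssp(2)[OF that]
      by (intro mult_left_mono) (auto simp: c P_def)
    then show ?thesis
      by (simp add: t_def algebra_simps)
  qed
  have t_nonneg: "0 \<le> t j" if "j \<in> {1..k}" for j
  proof -
    have "0 \<le> (\<alpha> j - c * \<beta> j) * poly P (real j)"
      using that le[OF that] by (simp add: P_j)
    then show ?thesis
      using t_ge[OF that] by linarith
  qed
  have t_0: "t j = 0" if "j \<in> {1..k}" for j
    using sum_t sum_nonneg_eq_0_iff[of "{1..k}" t] t_nonneg that by auto
  \<comment> \<open>The strict inequality in \<open>ssp\<close> is decisive:
    \<open>\<alpha> j \<le> c * \<beta> j\<close> contradicts it unless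
    \<open>\<beta> j = 0\<close>, and then \<open>\<alpha> j = 0\<close>.\<close>
  have zero: "\<alpha> j = 0 \<and> \<beta> j = 0" if j: "j \<in> {1..k}" and pos: "poly P (real j) > 0" for j
  proof -
    have "(\<alpha> j - c * \<beta> j) * poly P (real j) \<le> 0"
      using t_ge[OF j] t_0[OF j] by simp
    then have "\<alpha> j \<le> c * \<beta> j"
      using pos by (simp add: mult_le_0_iff)
    then show ?thesis
      using ssp[OF j] by (cases "\<beta> j = 0") auto
  qed
  have sum_\<alpha>: "(\<Sum>j=1..k. \<alpha> j) = 1"
    using ord by (simp add: has_order_def)
  show False
  proof (cases "n = 0")
    \<comment> \<open>Now \<open>P\<close> is \<open>x ^ 2\<close>, positive at every node including
      \<open>k\<close>.\<close>
    case True
    then have "(\<Sum>j=1..k. \<alpha> j) = 0"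
      using zero by (intro sum.neutral) (auto simp: P_j)
    with sum_\<alpha> show False
      by simp
  next
    case False
    have below: "\<alpha> j = 0" "\<beta> j = 0" if "j \<in> {1..k} - {k}" for j
      using that zero[of j] by (auto simp: P_j)
    have only_k: "(\<Sum>j=1..k. f j) = f k" if "\<And>j. j \<in> {1..k} - {k} \<Longrightarrow> f j = 0"
      for f :: "nat \<Rightarrow> real"
      using k that by (subst sum.remove[of _ k]) auto
    have "\<alpha> k = 1"
      using sum_\<alpha> only_k[of \<alpha>] below by simp
    have *: "real k ^ m = real m * real k ^ (m - 1) * \<beta> k" if "2 \<le> m" "m \<le> p" for m
    proof -
      have "(\<Sum>j=1..k. real j ^ m * \<alpha> j - real m * real j ^ (m - 1) * \<beta> j) = 0"
        using ord that unfolding has_order_def by (auto dest!: spec[of _ m])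
      then show ?thesis
        using only_k[of "\<lambda>j. real j ^ m * \<alpha> j - real m * real j ^ (m - 1) * \<beta> j"] below \<open>\<alpha> k = 1\<close>
        by simp
    qed
    \<comment> \<open>Since \<open>n > 0\<close> means \<open>p \<ge> 3\<close>, the conditions for
      \<open>m = 2\<close> and \<open>m = 3\<close> both apply, and they disagree on
      \<open>\<beta> k\<close>.\<close>
    have "real k = 2 * \<beta> k"
      using *[of 2] k p by (simp add: power2_eq_square)
    moreover have "real k = 3 * \<beta> k"
      using *[of 3] k p False by (simp add: n_def power3_eq_cube power2_eq_square)
    ultimately show False
      using k by simp
  qed
qed

text \<open>The order conditions force \<open>\<alpha> 1 = 1\<close> and
  \<open>\<beta> 1 = 1 / 2\<close>, whose ratio is 2.\<close>

lemma ssp_coeff_one_step_le: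
  assumes ord: "has_order 1 \<alpha> \<beta> 2"
  shows "ssp_coeff 1 \<alpha> \<beta> \<le> 2"
proof (rule ccontr)
  assume "\<not> ssp_coeff 1 \<alpha> \<beta> \<le> 2"
  then have "ereal 2 < ssp_coeff 1 \<alpha> \<beta>"
    by simp
  from less_ssp_coeffD(3)[OF _ this, of 1] have "\<beta> 1 \<noteq> 0 \<Longrightarrow> 2 * \<beta> 1 < \<alpha> 1"
    by simp
  moreover have "\<alpha> 1 = 1" "\<alpha> 1 - 2 * \<beta> 1 = 0"
    using ord by (auto simp: has_order_def dest!: spec[of _ "2::nat"])
  ultimately show False
    by (cases "\<beta> 1 = 0") auto
qed

theorem theorem4p1:
  fixes k p :: nat
  assumes "k \<ge> 1" and "p \<ge> 2"
  shows "(k \<ge> 2 \<and> p \<le> 2 * k \<longrightarrow> C_imp k p \<le> ereal ((2 * real k - real p) / (real k - 1))) \<and>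
         (p > 2 * k \<longrightarrow> C_imp k p \<le> 0) \<and>
         (k = 1 \<and> p = 2 \<longrightarrow> C_imp k p \<le> 2)"
proof (intro conjI impI; (elim conjE)?)
  assume "k \<ge> 2" "p \<le> 2 * k"
  then show "C_imp k p \<le> ereal ((2 * real k - real p) / (real k - 1))"
    using \<open>p \<ge> 2\<close> by (intro C_imp_le ssp_coeff_le) auto
next
  assume "p > 2 * k"
  then show "C_imp k p \<le> 0"
    \<comment> \<open>No method has this order, so the bound on its coefficient holds
      vacuously.\<close>
    using order_le_twice_steps by (intro C_imp_le) fastforce+
next
  assume "k = 1" "p = 2"
  then show "C_imp k p \<le> 2"
    using ssp_coeff_one_step_le by (intro C_imp_le) auto
qed

end
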